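(* $\lambda(ABA.BCB.DCD.DED.AEA)=4$.
   Context: A formula is a finite set of non-empty words over variables (fragments), written separated by dots. An occurrence of a formula $f$ in a word $w$ over an alphabet $\Sigma$ is a non-erasing morphism $h$ from variables to non-empty words over $\Sigma$ such that $h(\phi)$ is a factor of $w$ for every fragment $\phi$; $\lambda(f)$ is the smallest size of an alphabet over which there exists an infinite word containing no occurrence of $f$. *)

theory Defs
  imports Main "HOL-Library.Extended_Nat"
begin

text \<open>A fragment is a word over variables. Formulas are meant to be finite sets of
  non-empty fragments; the functions below do not depend on this restriction.\<close>

type_synonym 'v formula = "'v list set"

definition formula_vars :: "'v formula \<Rightarrow> 'v set" where
  "formula_vars f = (\<Union>\<phi>\<in>f. set \<phi>)"

text \<open>Infinite words are functions from positions to letters.\<close>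

definition infinite_word_over :: "'a set \<Rightarrow> (nat \<Rightarrow> 'a) \<Rightarrow> bool" where
  "infinite_word_over \<Sigma> w \<longleftrightarrow> range w \<subseteq> \<Sigma>"

definition is_factor :: "'a list \<Rightarrow> (nat \<Rightarrow> 'a) \<Rightarrow> bool" where
  "is_factor u w \<longleftrightarrow> (\<exists>i. u = map w [i..<i + length u])"

text \<open>A morphism of free monoids is given by the images of the variables.\<close>

definition morph :: "('v \<Rightarrow> 'a list) \<Rightarrow> 'v list \<Rightarrow> 'a list" where
  "morph h \<phi> = concat (map h \<phi>)"

definition occurrence :: "'a set \<Rightarrow> 'v formula \<Rightarrow> (nat \<Rightarrow> 'a) \<Rightarrow> ('v \<Rightarrow> 'a list) \<Rightarrow> bool" where
  "occurrence \<Sigma> f w h \<longleftrightarrow>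
     (\<forall>v\<in>formula_vars f. h v \<noteq> [] \<and> set (h v) \<subseteq> \<Sigma>) \<and>
     (\<forall>\<phi>\<in>f. is_factor (morph h \<phi>) w)"

definition avoids :: "'a set \<Rightarrow> (nat \<Rightarrow> 'a) \<Rightarrow> 'v formula \<Rightarrow> bool" where
  "avoids \<Sigma> w f \<longleftrightarrow> \<not> (\<exists>h. occurrence \<Sigma> f w h)"

definition avoidable_over :: "'a set \<Rightarrow> 'v formula \<Rightarrow> bool" where
  "avoidable_over \<Sigma> f \<longleftrightarrow> (\<exists>w. infinite_word_over \<Sigma> w \<and> avoids \<Sigma> w f)"

text \<open>The index takes values in the extended naturals because it is infinite for formulas that
  no finite alphabet avoids. Every finite alphabet has a copy among the natural numbers.\<close>

definition avoidability_index :: "'v formula \<Rightarrow> enat" where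
  "avoidability_index f =
     Inf {enat (card \<Sigma>) | \<Sigma> :: nat set. finite \<Sigma> \<and> avoidable_over \<Sigma> f}"

datatype var = A | B | C | D | E

end

theory Submission
  imports Defs "HOL-Library.Sublist"
begin

text \<open>
  Draw an arc from \<open>X\<close> to \<open>Y\<close> for each fragment \<open>XYX\<close>; the formula becomes an orientation
  \<open>A \<rightarrow> B \<rightarrow> C \<leftarrow> D \<rightarrow> E \<leftarrow> A\<close> of the 5-cycle.

  Upper bound: in the fixed point of \<open>0 \<mapsto> 01, 1 \<mapsto> 21, 2 \<mapsto> 03, 3 \<mapsto> 23\<close> every letter has the parity
  of its position. Hence two occurrences of \<open>X\<close> are at an even distance, and all five images have
  lengths of the same parity. If the lengths are odd, then the two ends of each arc start at
  positions of different parity, which is impossible on a cycle of odd length. If they are even,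
  then the occurrence can be pulled back through the 2-uniform morphism to one of half the size.

  Lower bound: an infinite word over a finite alphabet contains factors \<open>s u s v s u s\<close> with \<open>s\<close> of
  any prescribed length. If \<open>xy\<close> and \<open>yx\<close> are factors of \<open>s\<close>, then \<open>s u s\<close> contains \<open>x B x\<close> for some
  \<open>B\<close> that starts and ends with \<open>y\<close>, and between the two copies of \<open>B\<close> there is a \<open>C\<close> such that \<open>B C B\<close>
  and \<open>y C y\<close> are factors. So \<open>A = x\<close>, \<open>D = y\<close> can only fail if no \<open>E\<close> is surrounded both by \<open>x\<close> and by
  \<open>y\<close>. With \<open>x = y\<close> this forces \<open>s\<close> to be square-free, and a finite search shows that no long
  square-free ternary word satisfies the remaining restrictions with letters \<open>x\<close>, \<open>y\<close>, \<open>E\<close>.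
\<close>

section \<open>Factors\<close>

lemma is_factor_map_upt: "is_factor (map w [i..<j]) w"
  unfolding is_factor_def by (cases "i \<le> j") (auto intro!: exI[of _ i])

lemma is_factorE:
  assumes "is_factor u w"
  obtains i where "u = map w [i..<i + length u]"
  using assms unfolding is_factor_def by blast

lemma map_upt_append:
  "map w [i..<i + (m + n)] = map w [i..<i + m] @ map w [i + m..<i + m + n]"
  by (metis add.assoc le_add1 map_append upt_add_eq_append)

lemma is_factor_appendD:
  assumes "u @ v = map w [i..<i + length (u @ v)]"
  shows "u = map w [i..<i + length u]" "v = map w [i + length u..<i + length u + length v]"
proof -
  have "u @ v = map w [i..<i + length u] @ map w [i + length u..<i + length u + length v]"
    using assms by (simp add: map_upt_append)
  then show "u = map w [i..<i + length u]" "v = map w [i + length u..<i + length u + length v]"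
    by simp_all
qed

lemma is_factor_sublist:
  assumes "is_factor v w" "sublist u v"
  shows "is_factor u w"
proof -
  obtain p q where v: "v = p @ u @ q" using assms(2) by (auto simp: sublist_def)
  obtain i where i: "v = map w [i..<i + length v]" using assms(1) by (rule is_factorE)
  note * = is_factor_appendD(2)[OF i[unfolded v]]
  show ?thesis using is_factor_appendD(1)[OF *[folded length_append]] unfolding is_factor_def by blast
qed

lemma set_subset_if_is_factor:
  assumes "is_factor u w" "range w \<subseteq> S"
  shows "set u \<subseteq> S"
proof -
  obtain i where "u = map w [i..<i + length u]" using assms(1) by (rule is_factorE)
  then have "set u = w ` {i..<i + length u}" by (metis set_map set_upt)
  then show ?thesis using assms(2) by auto
qed

definition encloses :: "(nat \<Rightarrow> 'a) \<Rightarrow> 'a list \<Rightarrow> 'a list \<Rightarrow> bool" where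
  "encloses w x y \<longleftrightarrow> x \<noteq> [] \<and> y \<noteq> [] \<and> is_factor (x @ y @ x) w"

abbreviation five_cycle :: "var formula" where
  "five_cycle \<equiv> {[A, B, A], [B, C, B], [D, C, D], [D, E, D], [A, E, A]}"

lemma avoids_five_cycle_iff:
  assumes "range w \<subseteq> S"
  shows "avoids S w five_cycle \<longleftrightarrow>
    \<not> (\<exists>a b c d e. encloses w a b \<and> encloses w b c \<and> encloses w d c \<and> encloses w d e \<and> encloses w a e)"
    (is "_ \<longleftrightarrow> \<not> ?R")
proof -
  have "\<exists>h. occurrence S five_cycle w h" if R: ?R
  proof -
    obtain a b c d e where
      *: "encloses w a b" "encloses w b c" "encloses w d c" "encloses w d e" "encloses w a e"
      using R by blast
    define h where "h v = (case v of A \<Rightarrow> a | B \<Rightarrow> b | C \<Rightarrow> c | D \<Rightarrow> d | E \<Rightarrow> e)" for v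
    have "set (x @ y @ x) \<subseteq> S" if "encloses w x y" for x y
      using that assms set_subset_if_is_factor unfolding encloses_def by blast
    note sub = this[OF *(1)] this[OF *(2)] this[OF *(3)] this[OF *(4)] this[OF *(5)]
    have "occurrence S five_cycle w h"
      using * sub unfolding occurrence_def encloses_def
      by (simp add: formula_vars_def morph_def h_def)
    then show ?thesis by blast
  qed
  moreover have ?R if "occurrence S five_cycle w h" for h
    using that unfolding occurrence_def encloses_def
    by (rule_tac x = "h A" in exI, rule_tac x = "h B" in exI, rule_tac x = "h C" in exI,
        rule_tac x = "h D" in exI, rule_tac x = "h E" in exI)
       (simp add: formula_vars_def morph_def)
  ultimately show ?thesis unfolding avoids_def by blast
qed

section \<open>A word over four letters\<close>

text \<open>Letter \<open>n\<close> of the fixed point, computed from letter \<open>n div 2\<close>.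
  The first letter of an image depends only on the parity of the preimage, hence of its position;
  the second only on whether the preimage is below 2.\<close>

function b4 :: "nat \<Rightarrow> nat" where
  "b4 n = (if even n then (if 4 dvd n then 0 else 2) else (if b4 (n div 2) < 2 then 1 else 3))"
  by auto
termination by (relation "measure id") (auto simp: odd_pos)

declare b4.simps [simp del]

lemma b4_double: "b4 (2 * n) = (if even n then 0 else 2)"
  by (subst b4.simps) (auto elim!: evenE oddE; presburger)

lemma b4_Suc_double: "b4 (Suc (2 * n)) = (if b4 n < 2 then 1 else 3)"
  by (subst b4.simps) simp

lemma even_b4 [simp]: "even (b4 n) \<longleftrightarrow> even n"
  by (subst b4.simps) auto

lemma b4_less: "b4 n < 4"
  by (subst b4.simps) auto

lemma b4_eqI:
  assumes "even m \<longleftrightarrow> even n" "b4 m < 2 \<longleftrightarrow> b4 n < 2"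
  shows "b4 m = b4 n"
proof -
  have "even (b4 m) \<longleftrightarrow> even (b4 n)" using assms by simp
  then show ?thesis using assms b4_less[of m] b4_less[of n] by presburger
qed

text \<open>Equal letters force \<open>i\<close> and \<open>j\<close> to have the same parity. Each
  pair of adjacent letters then reveals both bits of a preimage letter, its parity and whether it is
  below 2. For odd \<open>i\<close> the parity bit is read from the next image.\<close>

lemma b4_halve:
  assumes eq: "\<And>k. k < 2 * l \<Longrightarrow> b4 (i + k) = b4 (j + k)" and k: "k < l"
  shows "b4 (i div 2 + k) = b4 (j div 2 + k)"
proof -
  have "even (b4 (i + 0)) \<longleftrightarrow> even (b4 (j + 0))" using eq[of 0] k by simp
  then have parity: "even i \<longleftrightarrow> even j" by simp
  have eq0: "b4 (i + 2 * k) = b4 (j + 2 * k)" and eq1: "b4 (i + (2 * k + 1)) = b4 (j + (2 * k + 1))"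
    using eq[of "2 * k"] eq[of "2 * k + 1"] k by linarith+
  show ?thesis
  proof (cases "even i")
    case True
    then obtain m n where mn: "i = 2 * m" "j = 2 * n" using parity by (auto elim!: evenE)
    have "b4 (2 * (m + k)) = b4 (2 * (n + k))" "b4 (Suc (2 * (m + k))) = b4 (Suc (2 * (n + k)))"
      using eq0 eq1 by (simp_all add: mn algebra_simps)
    then show ?thesis unfolding b4_double b4_Suc_double
      by (intro b4_eqI) (auto simp: mn split: if_splits)
  next
    case False
    then obtain m n where mn: "i = Suc (2 * m)" "j = Suc (2 * n)"
      using parity by (auto elim!: oddE)
    have "b4 (Suc (2 * (m + k))) = b4 (Suc (2 * (n + k)))" "b4 (2 * (m + k + 1)) = b4 (2 * (n + k + 1))"
      using eq0 eq1 by (simp_all add: mn algebra_simps)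
    then show ?thesis unfolding b4_double b4_Suc_double
      by (intro b4_eqI) (auto simp: mn split: if_splits)
  qed
qed

text \<open>The pull-back is read at an arbitrary occurrence; for even length the choice does not
  affect the result.\<close>

definition half :: "nat list \<Rightarrow> nat list" where
  "half u = (let i = SOME i. u = map b4 [i..<i + length u]
     in map b4 [i div 2..<i div 2 + length u div 2])"

lemma half_eq:
  assumes u: "u = map b4 [i..<i + length u]" and "even (length u)"
  shows "half u = map b4 [i div 2..<i div 2 + length u div 2]"
proof -
  define j where "j = (SOME j. u = map b4 [j..<j + length u])"
  have j: "u = map b4 [j..<j + length u]" unfolding j_def using u by (rule someI)
  have "b4 (j + k) = b4 (i + k)" if "k < 2 * (length u div 2)" for k
  proof -
    have "k < length u" using that by linarith
    then show ?thesis
      using arg_cong[OF u, of "\<lambda>v. v ! k"] arg_cong[OF j, of "\<lambda>v. v ! k"] by simp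
  qed
  then have "b4 (j div 2 + k) = b4 (i div 2 + k)" if "k < length u div 2" for k
    using b4_halve that by blast
  then show ?thesis unfolding half_def Let_def j_def[symmetric]
    by (intro nth_equalityI) simp_all
qed

lemma encloses_b4E:
  assumes "encloses b4 x y"
  obtains i where "x = map b4 [i..<i + length x]"
    "y = map b4 [i + length x..<i + length x + length y]"
    "x = map b4 [i + length x + length y..<i + length x + length y + length x]"
proof -
  obtain i where i: "x @ y @ x = map b4 [i..<i + length (x @ y @ x)]"
    using assms unfolding encloses_def by (meson is_factorE)
  note * = is_factor_appendD[OF i]
  note ** = is_factor_appendD[OF *(2)[folded length_append]]
  show ?thesis using that *(1) **[folded length_append] by blast
qed

lemma hd_map_upt:
  assumes "x = map w [i..<i + length x]" "x \<noteq> []"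
  shows "hd x = w i"
  using assms by (metis add_cancel_right_right le_add1 length_0_conv list.map_sel(1) map_is_Nil_conv
      nat_less_le hd_upt upt_eq_Nil_conv)

text \<open>The parity of \<open>hd x\<close> stands for the parity of every position at which
  \<open>x\<close> occurs.\<close>

lemma encloses_b4_parity:
  assumes "encloses b4 x y"
  shows "even (length x) \<longleftrightarrow> even (length y)"
    and "odd (length x) \<Longrightarrow> even (hd x) \<longleftrightarrow> odd (hd y)"
proof -
  have ne: "x \<noteq> []" "y \<noteq> []" using assms by (simp_all add: encloses_def)
  obtain i where i: "x = map b4 [i..<i + length x]"
    "y = map b4 [i + length x..<i + length x + length y]"
    "x = map b4 [i + length x + length y..<i + length x + length y + length x]"
    using assms by (rule encloses_b4E)
  have hd: "hd x = b4 i" "hd y = b4 (i + length x)" "hd x = b4 (i + length x + length y)"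
    using hd_map_upt[OF i(1) ne(1)] hd_map_upt[OF i(2) ne(2)] hd_map_upt[OF i(3) ne(1)] by simp_all
  have "even (b4 i) \<longleftrightarrow> even (b4 (i + length x + length y))" using hd by simp
  then show "even (length x) \<longleftrightarrow> even (length y)" by auto
  show "even (hd x) \<longleftrightarrow> odd (hd y)" if "odd (length x)" using that by (simp add: hd(1,2))
qed

lemma encloses_b4_half:
  assumes enc: "encloses b4 x y" and ev: "even (length x)"
  shows "encloses b4 (half x) (half y)"
proof -
  have ne: "x \<noteq> []" "y \<noteq> []" using assms by (simp_all add: encloses_def)
  have evy: "even (length y)" using encloses_b4_parity(1)[OF enc] ev by simp
  obtain m n where mn: "length x = 2 * m" "length y = 2 * n" using ev evy by (auto elim!: evenE)
  have pos: "0 < m" "0 < n" using ne mn by (metis length_0_conv mult_0_right neq0_conv)+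
  obtain i where i: "x = map b4 [i..<i + length x]"
    "y = map b4 [i + length x..<i + length x + length y]"
    "x = map b4 [i + length x + length y..<i + length x + length y + length x]"
    using enc by (rule encloses_b4E)
  let ?j = "i div 2"
  \<comment> \<open>As the lengths are even, the halved blocks remain adjacent, even for odd
    \<open>i\<close>.\<close>
  have j: "(i + length x) div 2 = ?j + m" "(i + length x + length y) div 2 = ?j + m + n"
    by (simp_all add: mn)
  have h: "half x = map b4 [?j..<?j + m]" "half y = map b4 [?j + m..<?j + m + n]"
    "half x = map b4 [?j + m + n..<?j + m + n + m]"
    using half_eq[OF i(1) ev] half_eq[OF i(2) evy] half_eq[OF i(3) ev] mn unfolding j by simp_all
  have "half x @ half y @ half x = map b4 [?j..<?j + (m + (n + m))]"
    unfolding map_upt_append using h by presburger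
  then have "is_factor (half x @ half y @ half x) b4" by (simp only: is_factor_map_upt)
  moreover have "half x \<noteq> []" "half y \<noteq> []" using pos h(1,2) by simp_all
  ultimately show ?thesis by (simp add: encloses_def)
qed

lemma b4_no_five_cycle:
  assumes "encloses b4 a b" "encloses b4 b c" "encloses b4 d c" "encloses b4 d e" "encloses b4 a e"
  shows False
  using assms
proof (induction "length a" arbitrary: a b c d e rule: less_induct)
  case less
  note len = less.prems[THEN encloses_b4_parity(1)]
  note hd = less.prems[THEN encloses_b4_parity(2)]
  show False
  proof (cases "even (length a)")
    case False
    then show False using len hd by blast
  next
    case True
    obtain i where i: "a = map b4 [i..<i + length a]" using less.prems(1) by (rule encloses_b4E)
    have "length (half a) = length a div 2" using half_eq[OF i True] by simp
    moreover have "a \<noteq> []" using less.prems(1) by (simp add: encloses_def)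
    ultimately have "length (half a) < length a" by simp
    moreover have "encloses b4 (half a) (half b)" "encloses b4 (half b) (half c)"
      "encloses b4 (half d) (half c)" "encloses b4 (half d) (half e)" "encloses b4 (half a) (half e)"
      using less.prems len True by (auto intro: encloses_b4_half)
    ultimately show False by (rule less.hyps)
  qed
qed

lemma avoidable_over_four: "avoidable_over {..<4::nat} five_cycle"
proof -
  have r: "range b4 \<subseteq> {..<4}" using b4_less by auto
  have "avoids {..<4} b4 five_cycle"
    unfolding avoids_five_cycle_iff[OF r] using b4_no_five_cycle by blast
  then show ?thesis using r unfolding avoidable_over_def infinite_word_over_def by blast
qed

section \<open>Unavoidability over three letters\<close>

lemma upt_append_upt: "i \<le> j \<Longrightarrow> j \<le> k \<Longrightarrow> [i..<j] @ [j..<k] = [i..<k]"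
  by (metis le_iff_add upt_add_eq_append)

lemma repeated_block:
  fixes w :: "nat \<Rightarrow> 'a"
  assumes "finite S" "range w \<subseteq> S" "0 < m"
  obtains l where "\<And>i. \<exists>s u. length s = m \<and> u \<noteq> [] \<and> sublist (s @ u @ s) (map w [i..<i + l])"
proof -
  define T where "T = {xs. set xs \<subseteq> S \<and> length xs = m}"
  have fin: "finite T" unfolding T_def using assms(1) by (rule finite_lists_length_eq)
  \<comment> \<open>Room for one more block of length \<open>m\<close> than there are such words.
    Spacing \<open>2 * m\<close> leaves a non-empty gap between any two blocks.\<close>
  define l where "l = 2 * m * (card T + 1)"
  have "\<exists>s u. length s = m \<and> u \<noteq> [] \<and> sublist (s @ u @ s) (map w [i..<i + l])" for i
  proof -
    define g where "g j = map w [i + 2 * m * j..<i + 2 * m * j + m]" for j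
    have "g ` {..card T} \<subseteq> T" using assms(2) unfolding g_def T_def by fastforce
    then have "card (g ` {..card T}) < card {..card T}"
      using card_mono[OF fin] by (simp add: le_imp_less_Suc)
    then have "\<not> inj_on g {..card T}" by (rule pigeonhole)
    then obtain j k where jk: "j < k" "k \<le> card T" "g j = g k"
      by (metis atMost_iff inj_onI linorder_neqE_nat)
    have jk': "2 * m * j + 2 * m \<le> 2 * m * k"
      using mult_le_mono2[of "Suc j" k "2 * m"] jk(1) by simp
    have kl: "2 * m * k + 2 * m \<le> l"
      using mult_le_mono2[of "Suc k" "card T + 1" "2 * m"] jk(2) by (simp add: l_def)
    let ?p = "i + 2 * m * j" and ?q = "i + 2 * m * k"
    let ?u = "map w [?p + m..<?q]"
    have "[i..<i + l] = [i..<?p] @ [?p..<?p + m] @ [?p + m..<?q] @ [?q..<?q + m] @ [?q + m..<i + l]"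
      by (rule sym) (use jk' kl assms(3) in \<open>simp add: upt_append_upt\<close>)
    then have "map w [i..<i + l] = map w [i..<?p] @ (g j @ ?u @ g k) @ map w [?q + m..<i + l]"
      by (simp only: g_def map_append append_assoc)
    then have "sublist (g j @ ?u @ g j) (map w [i..<i + l])" unfolding jk(3) sublist_def by blast
    moreover have "length (g j) = m" "?u \<noteq> []" using jk(1) jk' assms(3) by (simp_all add: g_def)
    ultimately show ?thesis by blast
  qed
  then show thesis by (rule that)
qed

text \<open>\<open>repeated_block\<close> is used twice: its bound \<open>l\<close> holds at every
  position, so a repeated \<open>t\<close> of length \<open>l\<close> itself contains some
  \<open>s @ u @ s\<close>.\<close>

lemma zimin3_factor:
  fixes w :: "nat \<Rightarrow> 'a"
  assumes "finite S" "range w \<subseteq> S" "0 < m"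
  obtains s u v where "length s = m" "u \<noteq> []" "v \<noteq> []" "is_factor (s @ u @ s @ v @ s @ u @ s) w"
proof -
  obtain l where l: "\<And>i. \<exists>s u. length s = m \<and> u \<noteq> [] \<and> sublist (s @ u @ s) (map w [i..<i + l])"
    using repeated_block[OF assms] by metis
  have "0 < l" using l[of 0] assms(3) by (intro gr0I) auto
  then obtain l' where "\<exists>t y. length t = l \<and> y \<noteq> [] \<and> sublist (t @ y @ t) (map w [0..<0 + l'])"
    using repeated_block[OF assms(1,2)] by metis
  then obtain t y where t: "length t = l" "y \<noteq> []" "sublist (t @ y @ t) (map w [0..<0 + l'])"
    by blast
  have fac: "is_factor (t @ y @ t) w" using is_factor_sublist[OF is_factor_map_upt t(3)] .
  then have "is_factor t w" by (rule is_factor_sublist) simp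
  then obtain i where "t = map w [i..<i + l]" using t(1) by (metis is_factorE)
  then obtain s u p q where s: "length s = m" "u \<noteq> []" "t = p @ (s @ u @ s) @ q"
    using l[of i] by (auto simp: sublist_def)
  have "t @ y @ t = p @ (s @ u @ s @ (q @ y @ p) @ s @ u @ s) @ q" by (simp add: s(3))
  then have "sublist (s @ u @ s @ (q @ y @ p) @ s @ u @ s) (t @ y @ t)"
    unfolding sublist_def by blast
  then have "is_factor (s @ u @ s @ (q @ y @ p) @ s @ u @ s) w" using fac is_factor_sublist by blast
  then show thesis using that s(1,2) t(2) by (metis append_is_Nil_conv)
qed

lemma five_cycle_in_zimin3:
  assumes fac: "is_factor (s @ u @ s @ v @ s @ u @ s) w"
    and xy: "sublist (x @ y) s" and yx: "sublist (y @ x) s" and ne: "x \<noteq> []" "y \<noteq> []"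
    and e: "x = y \<or> encloses w x e \<and> encloses w y e"
  shows "\<exists>a b c d e. encloses w a b \<and> encloses w b c \<and> encloses w d c \<and> encloses w d e \<and> encloses w a e"
proof -
  obtain p q where pq: "s = p @ x @ y @ q" using xy by (auto simp: sublist_def)
  obtain p' q' where pq': "s = p' @ y @ x @ q'" using yx by (auto simp: sublist_def)
  \<comment> \<open>\<open>b\<close> runs from the \<open>y\<close> of \<open>x @ y\<close> in one
    \<open>s\<close> to the \<open>y\<close> of \<open>y @ x\<close> in the next; \<open>c\<close>
    fills the space between the two copies of \<open>b\<close>.\<close>
  define b where "b = y @ q @ u @ p' @ y"
  define c where "c = x @ q' @ v @ p @ x"
  have sus: "s @ u @ s = p @ x @ b @ x @ q'"
  proof -
    have "s @ u @ s = (p @ x @ y @ q) @ u @ (p' @ y @ x @ q')" using pq pq' by metis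
    then show ?thesis by (simp add: b_def)
  qed
  have "s @ u @ s @ v @ s @ u @ s = (s @ u @ s) @ v @ (s @ u @ s)" by simp
  also have "\<dots> = p @ (x @ b @ c @ b @ x) @ q'" by (simp only: sus c_def append_assoc)
  finally have main: "is_factor (x @ b @ c @ b @ x) w"
    using fac is_factor_sublist unfolding sublist_def by metis
  have bcb: "is_factor (b @ c @ b) w"
    by (rule is_factor_sublist[OF main]) (auto simp: sublist_def intro!: exI[of _ x])
  have xbx: "is_factor (x @ b @ x) w"
  proof -
    have "x @ b @ c @ b @ x = [] @ (x @ b @ x) @ (q' @ v @ p @ x @ b @ x)" by (simp add: c_def)
    then show ?thesis using main is_factor_sublist unfolding sublist_def by metis
  qed
  have ycy: "is_factor (y @ c @ y) w"
  proof -
    have "b @ c @ b = (y @ q @ u @ p') @ (y @ c @ y) @ (q @ u @ p' @ y)" by (simp add: b_def)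
    then show ?thesis using bcb is_factor_sublist unfolding sublist_def by metis
  qed
  have "b \<noteq> []" "c \<noteq> []" using ne by (simp_all add: b_def c_def)
  then have "encloses w x b" "encloses w b c" "encloses w y c"
    using xbx bcb ycy ne by (simp_all add: encloses_def)
  \<comment> \<open>The witnesses are \<open>a = x\<close> and \<open>d = y\<close>; if
    \<open>x = y\<close>, then \<open>b\<close> also serves as \<open>e\<close>.\<close>
  then show ?thesis using e by blast
qed

section \<open>Exhaustive search through ternary words\<close>

datatype letter = L0 | L1 | L2

text \<open>\<open>u\<close> accumulates the root of the square; the test starts from
  \<open>[]\<close>.\<close>

fun square_prefix :: "'a list \<Rightarrow> 'a list \<Rightarrow> bool" where
  "square_prefix u [] \<longleftrightarrow> False"
| "square_prefix u (x # xs) \<longleftrightarrow> (if prefix (u @ [x]) xs then True else square_prefix (u @ [x]) xs)"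

text \<open>Here \<open>z\<close> is the image of \<open>E\<close>, surrounded by both
  \<open>x\<close> and \<open>y\<close>. Looking only in \<open>r\<close> may miss conflicts but
  never invents one.\<close>

fun palindrome_conflict :: "letter list \<Rightarrow> bool" where
  "palindrome_conflict (x # z # x' # r) \<longleftrightarrow>
     (if x' = x
      then \<exists>y\<in>set [L0, L1, L2]. y \<noteq> x \<and> sublist [y, z, y] r \<and> sublist [x, y] r \<and> sublist [y, x] r
      else False)"
| "palindrome_conflict _ \<longleftrightarrow> False"

text \<open>Words are extended to the left, so only the conflicts created by the first letter are tested.
  The case distinctions are written with \<open>if\<close> because the simplifier evaluates both sides of a
  disjunction, which would turn the search into an enumeration of all words.\<close>

fun conflict_within :: "nat \<Rightarrow> letter list \<Rightarrow> bool" where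
  "conflict_within 0 p \<longleftrightarrow> False"
| "conflict_within (Suc n) p \<longleftrightarrow>
     (if square_prefix [] p then True else if palindrome_conflict p then True
      else conflict_within n (L0 # p) \<and> conflict_within n (L1 # p) \<and> conflict_within n (L2 # p))"

lemma square_prefixD:
  assumes "square_prefix u p"
  shows "\<exists>x r. x \<noteq> [] \<and> u @ p = x @ x @ r"
  using assms
proof (induction u p rule: square_prefix.induct)
  case (2 u x xs)
  then consider "prefix (u @ [x]) xs" | "\<not> prefix (u @ [x]) xs" "square_prefix (u @ [x]) xs"
    by (auto split: if_splits)
  then show ?case
  proof cases
    case 1
    then obtain r where "xs = (u @ [x]) @ r" by (auto simp: prefix_def)
    then show ?thesis by (intro exI[of _ "u @ [x]"] exI[of _ r]) simp
  next
    case 2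
    then show ?thesis using "2.IH" by simp
  qed
qed simp

lemma palindrome_conflictD:
  assumes "palindrome_conflict p"
  shows "\<exists>x y z. sublist [x, z, x] p \<and> sublist [y, z, y] p \<and> sublist [x, y] p \<and> sublist [y, x] p"
  using assms
proof (induction p rule: palindrome_conflict.induct)
  case (1 x z x' r)
  then obtain y where y: "x' = x" "sublist [y, z, y] r" "sublist [x, y] r" "sublist [y, x] r"
    by (auto split: if_splits)
  have "sublist t (x # z # x' # r)" if "sublist t r" for t using that by (simp add: sublist_Cons_right)
  moreover have "sublist [x, z, x] (x # z # x' # r)" using y(1) by (simp add: sublist_Cons_right)
  ultimately show ?case using y by blast
qed simp_all

text \<open>The search prepends the letters of \<open>s\<close> from its last one on. Depth 0 counts
  as failure, so depth \<open>n\<close> explores at most \<open>n - 1\<close> added letters.\<close>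

lemma conflict_within_suffix:
  assumes "conflict_within n p" "n \<le> Suc (length s)"
  shows "\<exists>q. suffix q (s @ p) \<and> (square_prefix [] q \<or> palindrome_conflict q)"
  using assms
proof (induction n arbitrary: p s)
  case (Suc n)
  show ?case
  proof (cases "square_prefix [] p \<or> palindrome_conflict p")
    case True
    then show ?thesis by (auto simp: suffix_def)
  next
    case False
    then have step: "conflict_within n (c # p)" for c using Suc.prems(1) by (cases c) auto
    then have "n \<noteq> 0" by (intro notI) simp
    then obtain s' c where s: "s = s' @ [c]" using Suc.prems(2) by (cases s rule: rev_cases) auto
    have "n \<le> Suc (length s')" using Suc.prems(2) s by simp
    with step have "\<exists>q. suffix q (s' @ c # p) \<and> (square_prefix [] q \<or> palindrome_conflict q)"
      by (rule Suc.IH)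
    then show ?thesis using s by simp
  qed
qed simp

text \<open>By evaluation, every ternary word of length 26 has a conflict.\<close>

lemma conflict_within_27: "conflict_within 27 []"
  by code_simp

lemma ternary_contains_five_cycle:
  fixes w :: "nat \<Rightarrow> letter"
  shows "\<exists>a b c d e. encloses w a b \<and> encloses w b c \<and> encloses w d c \<and> encloses w d e \<and> encloses w a e"
proof -
  have "range w \<subseteq> {L0, L1, L2}" using letter.exhaust by blast
  then obtain s u v where s: "length s = 26" "is_factor (s @ u @ s @ v @ s @ u @ s) w"
    using zimin3_factor[of "{L0, L1, L2}" w 26] by (metis finite.emptyI finite.insertI zero_less_numeral)
  have fac: "is_factor s w" by (rule is_factor_sublist[OF s(2)]) simp
  obtain q where q: "suffix q s" "square_prefix [] q \<or> palindrome_conflict q"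
    using conflict_within_suffix[OF conflict_within_27, of s] s(1) by auto
  have sub: "sublist t s" if "sublist t q" for t
    using that q(1) suffix_imp_sublist sublist_order.order_trans by blast
  from q(2) show ?thesis
  proof
    assume "square_prefix [] q"
    then obtain x r where x: "x \<noteq> []" "q = x @ x @ r" using square_prefixD[of "[]" q] by auto
    then have "sublist (x @ x) q" unfolding sublist_def by (metis append_Nil append_assoc)
    then have "sublist (x @ x) s" by (rule sub)
    then show ?thesis using five_cycle_in_zimin3[OF s(2) _ _ x(1) x(1)] by blast
  next
    assume "palindrome_conflict q"
    then obtain x y z where
      xyz: "sublist [x, z, x] s" "sublist [y, z, y] s" "sublist [x, y] s" "sublist [y, x] s"
      using palindrome_conflictD sub by blast
    then have "encloses w [x] [z]" "encloses w [y] [z]"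
      using is_factor_sublist[OF fac] by (simp_all add: encloses_def)
    then show ?thesis using five_cycle_in_zimin3[OF s(2), of "[x]" "[y]"] xyz(3,4)
      by (metis append_Cons append_Nil list.distinct(1))
  qed
qed

section \<open>Transfer to arbitrary alphabets of at most three letters, and the index\<close>

lemma is_factor_map: "is_factor u w \<Longrightarrow> is_factor (map g u) (g \<circ> w)"
  unfolding is_factor_def by (metis length_map map_map)

lemma encloses_map: "encloses w x y \<Longrightarrow> encloses (g \<circ> w) (map g x) (map g y)"
  unfolding encloses_def using is_factor_map[of "x @ y @ x" w g] by simp

lemma not_avoidable_over_three:
  fixes S :: "'a set"
  assumes "finite S" "card S \<le> 3"
  shows "\<not> avoidable_over S five_cycle"
proof
  assume "avoidable_over S five_cycle"
  then obtain w where w: "range w \<subseteq> S" "avoids S w five_cycle"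
    unfolding avoidable_over_def infinite_word_over_def by blast
  have "card S \<le> card {L0, L1, L2}" using assms(2) by simp
  then obtain g :: "'a \<Rightarrow> letter" where g: "inj_on g S"
    using card_le_inj[OF assms(1), of "{L0, L1, L2}"] by auto
  define g' where "g' = inv_into S g"
  note ternary_contains_five_cycle[of "g \<circ> w"]
  \<comment> \<open>Decoding by \<open>g'\<close> carries the images found in
    \<open>g \<circ> w\<close> back to \<open>w\<close>.\<close>
  moreover have "g' \<circ> (g \<circ> w) = w" using g w(1) by (auto simp: g'_def fun_eq_iff intro!: inv_into_f_f)
  ultimately have "\<exists>a b c d e. encloses w a b \<and> encloses w b c \<and> encloses w d c \<and> encloses w d e \<and> encloses w a e"
    using encloses_map[of "g \<circ> w" _ _ g'] by metis
  then show False using w(2) unfolding avoids_five_cycle_iff[OF w(1)] by blast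
qed

theorem theorem15:
  "avoidability_index {[A, B, A], [B, C, B], [D, C, D], [D, E, D], [A, E, A]} = 4"
proof (rule antisym)
  have "enat (card {..<4::nat}) \<in> {enat (card \<Sigma>) | \<Sigma> :: nat set. finite \<Sigma> \<and> avoidable_over \<Sigma> five_cycle}"
    by (rule CollectI, rule exI[of _ "{..<4}"]) (simp add: avoidable_over_four)
  then have "avoidability_index five_cycle \<le> enat (card {..<4::nat})"
    unfolding avoidability_index_def by (rule Inf_lower)
  then show "avoidability_index five_cycle \<le> 4" by (simp add: numeral_eq_enat)
next
  have "4 \<le> enat (card \<Sigma>)" if "finite \<Sigma>" "avoidable_over \<Sigma> five_cycle" for \<Sigma> :: "nat set"
  proof -
    have "4 \<le> card \<Sigma>" using not_avoidable_over_three[OF that(1)] that(2) by linarith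
    then show ?thesis unfolding numeral_eq_enat enat_ord_simps .
  qed
  then show "4 \<le> avoidability_index five_cycle"
    unfolding avoidability_index_def by (intro Inf_greatest) blast
qed

end
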